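(* Let $m,l\ge2$ be integers, $n=ml$, let $\lambda\vdash n$, and put $r:=n-\lambda_1$ and $r':=n-\lambda_1'$. Then: (1) If $\lambda_1'>m$, then $K_{\lambda,(l^m)}=0$. (2) $K_{\lambda,(l^m)}\le m^r$. (3) $K_{\lambda,(l^m)}\le\binom nr K_{\lambda^*,\beta(r)}$. (4) $K_{\lambda,(l^m)}\le\binom n{r'} K_{\lambda^\bullet,\beta(r')}$. Here, for an integer $s\ge0$, $\beta(s)$ denotes the partition of $s$ consisting of $s-m\lfloor s/m\rfloor$ parts equal to $\lfloor s/m\rfloor+1$ and $m\lfloor s/m\rfloor+m-s$ parts equal to $\lfloor s/m\rfloor$ (parts equal to $0$ being allowed).
   Context: $\lambda\vdash n$ means that $\lambda=(\lambda_1\ge\lambda_2\ge\cdots)$ is a partition of $n$; $\lambda'=(\lambda_1',\lambda_2',\dots)$ is the conjugate partition. $\lambda^*=(\lambda_2,\lambda_3,\dots)$ is $\lambda$ with its first row deleted, and $\lambda^\bullet=((\lambda')^* )'$ is $\lambda$ with its first column deleted. $K_{\lambda,\alpha}$ is the Kostka number: the number of semistandard Young tableaux of shape $\lambda$ and weight $\alpha$. $(l^m)$ is the partition with $m$ parts all equal to $l$. The Kostka number of the empty shape and zero weight is $1$. *)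

theory Defs
  imports Complex_Main "HOL-Library.FuncSet"
begin

text \<open>Weights may contain zero entries; partitions may not.\<close>

definition is_partition :: "nat list \<Rightarrow> nat \<Rightarrow> bool"  (infix "\<turnstile>" 50) where
  "\<mu> \<turnstile> n \<longleftrightarrow> sorted_wrt (\<ge>) \<mu> \<and> 0 \<notin> set \<mu> \<and> sum_list \<mu> = n"

text \<open>Parts are numbered from 1, with \<open>\<mu>\<^sub>i = 0\<close> beyond the length of the list
  (and, as a dummy value, for \<open>i = 0\<close>).\<close>

definition part :: "nat list \<Rightarrow> nat \<Rightarrow> nat" where
  "part \<mu> i = (if 1 \<le> i \<and> i \<le> length \<mu> then \<mu> ! (i - 1) else 0)"

text \<open>\<open>\<mu>'\<^sub>j\<close> is the number of parts \<open>\<mu>\<^sub>i \<ge> j\<close>, for \<open>j = 1, \<dots>, \<mu>\<^sub>1\<close>.\<close>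

definition conjugate :: "nat list \<Rightarrow> nat list" where
  "conjugate \<mu> = map (\<lambda>j. length (filter (\<lambda>x. j \<le> x) \<mu>)) [1..<part \<mu> 1 + 1]"

definition delete_row :: "nat list \<Rightarrow> nat list" where
  "delete_row \<mu> = tl \<mu>"

definition delete_column :: "nat list \<Rightarrow> nat list" where
  "delete_column \<mu> = conjugate (delete_row (conjugate \<mu>))"

text \<open>Cell \<open>(i, j)\<close> is in row \<open>i\<close> and column \<open>j\<close>.\<close>

definition young_diagram :: "nat list \<Rightarrow> (nat \<times> nat) set" where
  "young_diagram \<mu> = {(i, j). 1 \<le> i \<and> 1 \<le> j \<and> j \<le> part \<mu> i}"

text \<open>Tableaux are extensional (\<open>undefined\<close> outside the diagram), so that two of
  them are equal iff they agree on every cell of the diagram.\<close>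

definition semistandard :: "nat list \<Rightarrow> (nat \<times> nat \<Rightarrow> nat) \<Rightarrow> bool" where
  "semistandard \<mu> T \<longleftrightarrow>
     T \<in> young_diagram \<mu> \<rightarrow>\<^sub>E {1..} \<and>
     (\<forall>i j k. (i, j) \<in> young_diagram \<mu> \<longrightarrow> (i, k) \<in> young_diagram \<mu> \<longrightarrow>
        j < k \<longrightarrow> T (i, j) \<le> T (i, k)) \<and>
     (\<forall>h i j. (h, j) \<in> young_diagram \<mu> \<longrightarrow> (i, j) \<in> young_diagram \<mu> \<longrightarrow>
        h < i \<longrightarrow> T (h, j) < T (i, j))"

definition has_weight :: "nat list \<Rightarrow> (nat \<times> nat \<Rightarrow> nat) \<Rightarrow> nat list \<Rightarrow> bool" where
  "has_weight \<mu> T \<alpha> \<longleftrightarrow> (\<forall>k\<ge>1. card {c \<in> young_diagram \<mu>. T c = k} = part \<alpha> k)"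

definition SSYT :: "nat list \<Rightarrow> nat list \<Rightarrow> (nat \<times> nat \<Rightarrow> nat) set" where
  "SSYT \<mu> \<alpha> = {T. semistandard \<mu> T \<and> has_weight \<mu> T \<alpha>}"

definition kostka :: "nat list \<Rightarrow> nat list \<Rightarrow> nat" where
  "kostka \<mu> \<alpha> = card (SSYT \<mu> \<alpha>)"

text \<open>The partition of \<open>s\<close> into \<open>m\<close> parts (zeros allowed) that are as equal as possible.\<close>

definition beta :: "nat \<Rightarrow> nat \<Rightarrow> nat list" where
  "beta m s = replicate (s - m * (s div m)) (s div m + 1) @
              replicate (m * (s div m) + m - s) (s div m)"

lemma finite_young_diagram: "finite (young_diagram \<mu>)"
proof (rule finite_subset)
  show "young_diagram \<mu> \<subseteq> (SIGMA i:{1..length \<mu>}. {1..part \<mu> i})"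
    by (auto simp: young_diagram_def part_def split: if_splits)
qed auto

text \<open>The set counted by \<^const>\<open>kostka\<close> is finite, so \<^const>\<open>card\<close> has its intended meaning.\<close>

lemma finite_SSYT: "finite (SSYT \<mu> \<alpha>)"
proof (rule finite_subset)
  show "SSYT \<mu> \<alpha> \<subseteq> young_diagram \<mu> \<rightarrow>\<^sub>E {1..length \<alpha>}"
  proof
    fix T assume "T \<in> SSYT \<mu> \<alpha>"
    then have T: "T \<in> young_diagram \<mu> \<rightarrow>\<^sub>E {1..}" and w: "has_weight \<mu> T \<alpha>"
      by (auto simp: SSYT_def semistandard_def)
    have "T c \<le> length \<alpha>" if c: "c \<in> young_diagram \<mu>" for c
    proof -
      have "T c \<ge> 1" using T c by auto
      then have "card {d \<in> young_diagram \<mu>. T d = T c} = part \<alpha> (T c)"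
        using w by (simp add: has_weight_def)
      moreover have "card {d \<in> young_diagram \<mu>. T d = T c} > 0"
        using c finite_young_diagram[of \<mu>]
        by (subst card_gt_0_iff) (metis (mono_tags, lifting) empty_iff finite_subset mem_Collect_eq subsetI)
      ultimately show ?thesis by (auto simp: part_def split: if_splits)
    qed
    with T show "T \<in> young_diagram \<mu> \<rightarrow>\<^sub>E {1..length \<alpha>}"
      by (fastforce simp: PiE_iff)
  qed
  show "finite (young_diagram \<mu> \<rightarrow>\<^sub>E {1..length \<alpha>})"
    by (intro finite_PiE finite_young_diagram) auto
qed

lemma kostka_empty: "kostka [] (replicate m 0) = 1"
proof -
  have "young_diagram [] = {}"
    by (auto simp: young_diagram_def part_def)
  moreover have "part (replicate m 0) k = 0" for k
    by (auto simp: part_def)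
  ultimately have "SSYT [] (replicate m 0) = {\<lambda>_. undefined}"
    by (auto simp: SSYT_def semistandard_def has_weight_def)
  then show ?thesis by (simp add: kostka_def)
qed

end

theory Submission
  imports Defs "HOL-Library.Multiset"
begin

text \<open>
  A tableau is determined by its weight together with its entries outside the first row (or column).
  There are \<open>m\<^sup>r\<close> fillings of the cells outside the first row, which gives (2). Removing the first
  row or column leaves a tableau whose weight is one of the at most \<open>ml choose r\<close> sequences in
  \<open>{0..l}\<^sup>m\<close> with sum \<open>r\<close>, so (3) and (4) reduce to showing that, for a given shape, the Kostka
  number is largest at the balanced weight \<open>\<beta>(r)\<close>. For this, consider two consecutive letters with
  the entries of all other values fixed: by the description of tableaux as chains of interlacing
  shapes, the intermediate shape ranges over the points of a box having a prescribed coordinate sum,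
  and the number of such points is a symmetric unimodal function of that sum. Hence swapping two
  adjacent parts of the weight keeps the Kostka number, and moving them closer does not decrease it.
\<close>

section \<open>Tableaux on shapes given by row-length functions\<close>

definition diagram :: "(nat \<Rightarrow> nat) \<Rightarrow> (nat \<times> nat) set" where
  "diagram f = {(i, j). 1 \<le> i \<and> 1 \<le> j \<and> j \<le> f i}"

text \<open>\<open>L\<close> only bounds the number of rows. It stays fixed while cells are removed,
  so all sizes are sums over \<open>{1..L}\<close>. The value \<open>f 0 = 0\<close> makes
  \<open>f\<close> determined by its diagram, so that counting functions counts shapes.\<close>

definition shape :: "nat \<Rightarrow> (nat \<Rightarrow> nat) \<Rightarrow> bool" where
  "shape L f \<longleftrightarrow> f 0 = 0 \<and> (\<forall>i\<ge>1. f (Suc i) \<le> f i) \<and> (\<forall>i>L. f i = 0)"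

definition tableau :: "(nat \<Rightarrow> nat) \<Rightarrow> (nat \<times> nat \<Rightarrow> nat) \<Rightarrow> bool" where
  "tableau f T \<longleftrightarrow>
     T \<in> diagram f \<rightarrow>\<^sub>E {1..} \<and>
     (\<forall>i j k. (i, j) \<in> diagram f \<longrightarrow> (i, k) \<in> diagram f \<longrightarrow> j < k \<longrightarrow> T (i, j) \<le> T (i, k)) \<and>
     (\<forall>h i j. (h, j) \<in> diagram f \<longrightarrow> (i, j) \<in> diagram f \<longrightarrow> h < i \<longrightarrow> T (h, j) < T (i, j))"

definition tableaux :: "(nat \<Rightarrow> nat) \<Rightarrow> nat list \<Rightarrow> (nat \<times> nat \<Rightarrow> nat) set" where
  "tableaux f \<alpha> = {T. tableau f T \<and> (\<forall>k\<ge>1. card {c \<in> diagram f. T c = k} = part \<alpha> k)}"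

lemma young_diagram_eq: "young_diagram \<mu> = diagram (part \<mu>)"
  by (simp add: young_diagram_def diagram_def)

lemma SSYT_eq_tableaux: "SSYT \<mu> \<alpha> = tableaux (part \<mu>) \<alpha>"
  by (simp add: SSYT_def tableaux_def semistandard_def tableau_def has_weight_def young_diagram_eq)

lemma shape_antimono:
  assumes "shape L f" "1 \<le> h" "h \<le> i"
  shows "f i \<le> f h"
  using assms(3,2)
proof (induction i rule: dec_induct)
  case (step k)
  then show ?case using assms(1) by (meson le_trans shape_def)
qed simp

lemma diagram_Sigma: "shape L f \<Longrightarrow> diagram f = (SIGMA i:{1..L}. {1..f i})"
  unfolding shape_def diagram_def by (fastforce simp: not_le[symmetric])

lemma finite_diagram: "shape L f \<Longrightarrow> finite (diagram f)"
  by (simp add: diagram_Sigma)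

lemma card_diagram: "shape L f \<Longrightarrow> card (diagram f) = sum f {1..L}"
  by (simp add: diagram_Sigma)

lemma tableau_pos: "tableau f T \<Longrightarrow> c \<in> diagram f \<Longrightarrow> 1 \<le> T c"
  unfolding tableau_def by (auto simp: PiE_iff)

lemma tableaux_entry_bounds:
  assumes "shape L f" "T \<in> tableaux f \<alpha>" "c \<in> diagram f"
  shows "1 \<le> T c" "T c \<le> length \<alpha>"
proof -
  show pos: "1 \<le> T c"
    using assms(2,3) tableau_pos[of f T c] by (simp add: tableaux_def)
  have "{d \<in> diagram f. T d = T c} \<noteq> {}" using assms(3) by blast
  then have "card {d \<in> diagram f. T d = T c} \<noteq> 0"
    using finite_diagram[OF assms(1)] by simp
  then have "part \<alpha> (T c) \<noteq> 0"
    using assms(2) pos by (simp add: tableaux_def)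
  then show "T c \<le> length \<alpha>" by (auto simp: Defs.part_def split: if_splits)
qed

lemma finite_tableaux:
  assumes "shape L f"
  shows "finite (tableaux f \<alpha>)"
proof (rule finite_subset)
  show "tableaux f \<alpha> \<subseteq> diagram f \<rightarrow>\<^sub>E {1..length \<alpha>}"
  proof
    fix T assume T: "T \<in> tableaux f \<alpha>"
    then have "T \<in> diagram f \<rightarrow>\<^sub>E {1..}" by (simp add: tableaux_def tableau_def)
    with tableaux_entry_bounds[OF assms T] show "T \<in> diagram f \<rightarrow>\<^sub>E {1..length \<alpha>}"
      by (auto simp: PiE_iff)
  qed
  show "finite (diagram f \<rightarrow>\<^sub>E {1..length \<alpha>})"
    by (intro finite_PiE finite_diagram[OF assms]) auto
qed

section \<open>Removing the largest letter\<close>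

text \<open>For shapes this says that the skew shape \<open>f / g\<close> is a horizontal strip: it
  has at most one cell in each column.\<close>

definition interlace :: "(nat \<Rightarrow> nat) \<Rightarrow> (nat \<Rightarrow> nat) \<Rightarrow> bool" where
  "interlace f g \<longleftrightarrow> g 0 = 0 \<and> (\<forall>i\<ge>1. f (Suc i) \<le> g i \<and> g i \<le> f i)"

lemma shape_interlace:
  assumes "shape L f" "interlace f g"
  shows "shape L g"
  using assms unfolding shape_def interlace_def
  by (metis One_nat_def Suc_leI le_0_eq le_SucI le_trans less_eq_Suc_le zero_less_Suc not_less_zero bot_nat_0.not_eq_extremum)

lemma finite_interlace:
  assumes "shape L f"
  shows "finite {g. interlace f g}"
proof -
  have "{g. interlace f g} \<subseteq> (\<lambda>x i. if i \<in> {1..L} then x i else 0) ` (PiE {1..L} (\<lambda>i. {..f i}))"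
  proof
    fix g assume "g \<in> {g. interlace f g}"
    then have g: "interlace f g" by simp
    then have s: "shape L g" using shape_interlace[OF assms] by simp
    have "g = (\<lambda>i. if i \<in> {1..L} then restrict g {1..L} i else 0)"
      using s by (auto simp: fun_eq_iff shape_def not_le)
    moreover have "restrict g {1..L} \<in> PiE {1..L} (\<lambda>i. {..f i})"
      using g by (auto simp: interlace_def)
    ultimately show "g \<in> (\<lambda>x i. if i \<in> {1..L} then x i else 0) ` (PiE {1..L} (\<lambda>i. {..f i}))"
      by blast
  qed
  then show ?thesis by (rule finite_subset) (intro finite_imageI finite_PiE; simp)
qed

text \<open>Lets a left-justified set of cells in a row be replaced by its length.\<close>

lemma down_closed_eq_atLeastAtMost_card:
  assumes "finite A" "A \<subseteq> {1..}" "\<And>j k. k \<in> A \<Longrightarrow> 1 \<le> j \<Longrightarrow> j < k \<Longrightarrow> j \<in> A"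
  shows "A = {1..card A}"
proof (cases "A = {}")
  case False
  have "A = {1..Max A}"
  proof
    show "A \<subseteq> {1..Max A}" using assms(1,2) by auto
    show "{1..Max A} \<subseteq> A"
      using assms(3)[OF Max_in[OF assms(1) False]] Max_in[OF assms(1) False]
      by (metis atLeastAtMost_iff le_neq_implies_less subsetI)
  qed
  then show ?thesis by (metis card_atLeastAtMost diff_Suc_1)
qed simp

definition small_shape :: "(nat \<Rightarrow> nat) \<Rightarrow> nat \<Rightarrow> (nat \<times> nat \<Rightarrow> nat) \<Rightarrow> nat \<Rightarrow> nat" where
  "small_shape f M T i = card {j. (i, j) \<in> diagram f \<and> T (i, j) < M}"

text \<open>Rows increase weakly, so the entries below \<open>M\<close> occupy an initial segment of
  each row and counting them loses no information.\<close>

lemma diagram_small_shape: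
  assumes "tableau f T"
  shows "(i, j) \<in> diagram (small_shape f M T) \<longleftrightarrow> (i, j) \<in> diagram f \<and> T (i, j) < M"
proof -
  let ?A = "{j. (i, j) \<in> diagram f \<and> T (i, j) < M}"
  have "?A = {1..card ?A}"
  proof (rule down_closed_eq_atLeastAtMost_card)
    show "finite ?A" by (rule finite_subset[of _ "{1..f i}"]) (auto simp: diagram_def)
    show "?A \<subseteq> {1..}" by (auto simp: diagram_def)
    fix j k assume k: "k \<in> ?A" and j: "1 \<le> j" "j < k"
    then have "(i, j) \<in> diagram f" by (auto simp: diagram_def)
    moreover then have "T (i, j) \<le> T (i, k)" using assms k j by (auto simp: tableau_def)
    ultimately show "j \<in> ?A" using k by auto
  qed
  then have "j \<in> ?A \<longleftrightarrow> j \<in> {1..card ?A}" by simp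
  moreover have "?A = {}" if "i = 0" using that by (auto simp: diagram_def)
  ultimately show ?thesis
    by (cases "i = 0") (auto simp: diagram_def[of "small_shape f M T"] small_shape_def)
qed

lemma card_strip:
  assumes "shape L f" "interlace f g"
  shows "card (diagram f - diagram g) + sum g {1..L} = sum f {1..L}"
proof -
  have sub: "diagram g \<subseteq> diagram f"
    using assms(2) unfolding diagram_def interlace_def by fastforce
  show ?thesis
    using card_Diff_subset[OF finite_diagram[OF shape_interlace[OF assms]] sub]
      card_mono[OF finite_diagram[OF assms(1)] sub]
    by (simp add: card_diagram[OF assms(1)] card_diagram[OF shape_interlace[OF assms]])
qed

lemma part_append_last: "part (\<alpha> @ [a]) k = (if k = Suc (length \<alpha>) then a else part \<alpha> k)"
  by (auto simp: Defs.part_def nth_append)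

text \<open>Cutting off the largest letter: its cells form a horizontal strip because columns
  increase strictly.\<close>

lemma small_shape_tableaux:
  assumes f: "shape L f" and T: "T \<in> tableaux f (\<alpha> @ [a])"
  defines "g \<equiv> small_shape f (Suc (length \<alpha>)) T"
  shows "interlace f g" "sum g {1..L} + a = sum f {1..L}"
    "restrict T (diagram g) \<in> tableaux g \<alpha>"
    "\<And>c. c \<in> diagram f \<Longrightarrow> c \<notin> diagram g \<Longrightarrow> T c = Suc (length \<alpha>)"
proof -
  let ?M = "Suc (length \<alpha>)"
  have tab: "tableau f T" using T by (simp add: tableaux_def)
  note dg = diagram_small_shape[OF tab, of _ _ ?M, folded g_def]
  have le: "T c \<le> ?M" if "c \<in> diagram f" for c
    using tableaux_entry_bounds[OF f T that] by simp
  have g0: "g 0 = 0" by (simp add: g_def small_shape_def diagram_def)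
  have gf: "g i \<le> f i" if "1 \<le> i" for i
    using dg[of i "g i"] that by (cases "g i = 0") (auto simp: diagram_def)
  have fg: "f (Suc i) \<le> g i" if i: "1 \<le> i" for i
  proof (cases "f (Suc i) = 0")
    case False
    let ?j = "f (Suc i)"
    have c: "(Suc i, ?j) \<in> diagram f" using False by (auto simp: diagram_def)
    have d: "(i, ?j) \<in> diagram f" using False i f by (auto simp: diagram_def shape_def)
    \<comment> \<open>The cell above the last cell of row \<open>Suc i\<close> has an entry strictly
      below the largest letter, so row \<open>i\<close> of \<open>g\<close> reaches at least that
      far.\<close>
    have "T (i, ?j) < T (Suc i, ?j)" using tab c d unfolding tableau_def by blast
    with le[OF c] d have "(i, ?j) \<in> diagram g" by (simp add: dg)
    then show ?thesis by (simp add: diagram_def)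
  qed simp
  show il: "interlace f g" using g0 gf fg by (simp add: interlace_def)
  show top: "T c = ?M" if "c \<in> diagram f" "c \<notin> diagram g" for c
    using that le[of c] dg by (cases c) fastforce
  have "{c \<in> diagram f. T c = ?M} = diagram f - diagram g"
    using top dg by fastforce
  moreover have "card {c \<in> diagram f. T c = ?M} = a"
    using T by (simp add: tableaux_def part_append_last)
  ultimately show "sum g {1..L} + a = sum f {1..L}"
    using card_strip[OF f il] by simp
  have sub: "diagram g \<subseteq> diagram f" using dg by auto
  have "tableau g (restrict T (diagram g))"
    using tab sub unfolding tableau_def by (auto simp: PiE_iff subset_iff)
  moreover have "card {c \<in> diagram g. restrict T (diagram g) c = k} = part \<alpha> k" if k: "1 \<le> k" for k
  proof (cases "k < ?M")
    case True
    then have "{c \<in> diagram g. restrict T (diagram g) c = k} = {c \<in> diagram f. T c = k}"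
      using dg by fastforce
    then show ?thesis using T k True by (simp add: tableaux_def part_append_last)
  next
    case False
    then have "{c \<in> diagram g. restrict T (diagram g) c = k} = {}"
      using dg by fastforce
    then show ?thesis using False by (simp only: card.empty) (simp add: Defs.part_def)
  qed
  ultimately show "restrict T (diagram g) \<in> tableaux g \<alpha>"
    by (simp add: tableaux_def)
qed

text \<open>The inverse construction: filling a horizontal strip with a new largest letter keeps
  columns strict.\<close>

lemma add_strip_tableaux:
  assumes f: "shape L f" and il: "interlace f g" and sz: "sum g {1..L} + a = sum f {1..L}"
    and S: "S \<in> tableaux g \<alpha>"
  defines "T \<equiv> \<lambda>c. if c \<in> diagram g then S c else if c \<in> diagram f then Suc (length \<alpha>) else undefined"
  shows "T \<in> tableaux f (\<alpha> @ [a])" "small_shape f (Suc (length \<alpha>)) T = g"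
    "restrict T (diagram g) = S"
proof -
  let ?M = "Suc (length \<alpha>)"
  have g: "shape L g" using shape_interlace[OF f il] .
  have sub: "diagram g \<subseteq> diagram f"
    using il unfolding diagram_def interlace_def by fastforce
  have tab: "tableau g S" using S by (simp add: tableaux_def)
  have S_le: "1 \<le> S c" "S c < ?M" if "c \<in> diagram g" for c
    using tableaux_entry_bounds[OF g S that] by auto
  have "T \<in> diagram f \<rightarrow>\<^sub>E {1..}"
    using sub S_le(1) by (auto simp: T_def PiE_iff extensional_def)
  moreover have "T (i, j) \<le> T (i, k)"
    if "(i, j) \<in> diagram f" "(i, k) \<in> diagram f" "j < k" for i j k
  proof (cases "(i, k) \<in> diagram g")
    case True
    then have "(i, j) \<in> diagram g" using that by (auto simp: diagram_def)
    then show ?thesis using True tab that(3) by (simp add: T_def tableau_def)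
  next
    case False
    then show ?thesis using that S_le(2)[of "(i, j)"] by (auto simp: T_def)
  qed
  moreover have "T (h, j) < T (i, j)"
    if c: "(h, j) \<in> diagram f" "(i, j) \<in> diagram f" "h < i" for h i j
  proof -
    \<comment> \<open>A cell with another cell of \<open>f\<close> below it in its column lies in
      \<open>g\<close>, so no column receives two new cells.\<close>
    have "f i \<le> f (Suc h)" using c shape_antimono[OF f, of "Suc h" i] by simp
    also have "\<dots> \<le> g h" using il c(1) by (simp add: interlace_def diagram_def)
    finally have hg: "(h, j) \<in> diagram g" using c by (auto simp: diagram_def)
    show ?thesis
    proof (cases "(i, j) \<in> diagram g")
      case True
      then show ?thesis using hg tab c(3) by (simp add: T_def tableau_def)
    next
      case False
      then show ?thesis using hg c S_le(2)[OF hg] by (simp add: T_def)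
    qed
  qed
  ultimately have tabT: "tableau f T" by (simp add: tableau_def)
  moreover have "card {c \<in> diagram f. T c = k} = part (\<alpha> @ [a]) k" if k: "1 \<le> k" for k
  proof (cases "k = ?M")
    case True
    then have "{c \<in> diagram f. T c = k} = diagram f - diagram g"
      using S_le(2) by (fastforce simp: T_def)
    then show ?thesis using True card_strip[OF f il] sz by (simp add: part_append_last)
  next
    case False
    then have "{c \<in> diagram f. T c = k} = {c \<in> diagram g. S c = k}"
      using sub by (auto simp: T_def)
    then show ?thesis using S k False by (simp add: part_append_last tableaux_def)
  qed
  ultimately show "T \<in> tableaux f (\<alpha> @ [a])" by (simp add: tableaux_def)
  show "restrict T (diagram g) = S"
    using tab by (auto simp: fun_eq_iff T_def tableau_def PiE_iff extensional_def)
  show "small_shape f ?M T = g"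
  proof
    fix i
    have "{j. (i, j) \<in> diagram f \<and> T (i, j) < ?M} = {j. (i, j) \<in> diagram g}"
      using sub S_le(2) by (auto simp: T_def split: if_splits)
    also have "\<dots> = {1..g i}"
      using il by (cases "i = 0") (auto simp: diagram_def interlace_def)
    finally show "small_shape f ?M T i = g i" by (simp add: small_shape_def)
  qed
qed

text \<open>The branching rule for Kostka numbers: a tableau amounts to the shape \<open>g\<close>
  of its smaller letters and its restriction to \<open>g\<close>.\<close>

lemma card_tableaux_append_last:
  assumes f: "shape L f"
  shows "card (tableaux f (\<alpha> @ [a])) =
    (\<Sum>g | interlace f g \<and> sum g {1..L} + a = sum f {1..L}. card (tableaux g \<alpha>))"
proof -
  let ?B = "{g. interlace f g \<and> sum g {1..L} + a = sum f {1..L}}"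
  let ?M = "Suc (length \<alpha>)"
  let ?F = "\<lambda>T. (small_shape f ?M T, restrict T (diagram (small_shape f ?M T)))"
  let ?G = "\<lambda>(g, S) c. if c \<in> diagram g then S c else if c \<in> diagram f then ?M else undefined"
  have "bij_betw ?F (tableaux f (\<alpha> @ [a])) (SIGMA g:?B. tableaux g \<alpha>)"
  proof (rule bij_betw_byWitness[where f' = ?G])
    show "\<forall>T\<in>tableaux f (\<alpha> @ [a]). ?G (?F T) = T"
    proof
      fix T assume T: "T \<in> tableaux f (\<alpha> @ [a])"
      \<comment> \<open>Extensionality matches the default \<open>undefined\<close> used by
        \<open>?G\<close> outside \<open>f\<close>.\<close>
      have "T \<in> extensional (diagram f)" using T by (simp add: tableaux_def tableau_def PiE_iff)
      moreover have "diagram (small_shape f ?M T) \<subseteq> diagram f"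
        using T diagram_small_shape[of f T] by (auto simp: tableaux_def)
      ultimately show "?G (?F T) = T"
        using small_shape_tableaux(4)[OF f T] by (auto simp: fun_eq_iff extensional_def)
    qed
    show "\<forall>p\<in>SIGMA g:?B. tableaux g \<alpha>. ?F (?G p) = p"
    proof
      fix p assume "p \<in> (SIGMA g:?B. tableaux g \<alpha>)"
      then obtain g S where p: "p = (g, S)" "interlace f g" "sum g {1..L} + a = sum f {1..L}"
        "S \<in> tableaux g \<alpha>" by auto
      show "?F (?G p) = p"
        using add_strip_tableaux(2,3)[OF f p(2-4)] by (simp add: p(1))
    qed
    show "?F ` tableaux f (\<alpha> @ [a]) \<subseteq> (SIGMA g:?B. tableaux g \<alpha>)"
      using small_shape_tableaux(1-3)[OF f] by auto
    show "?G ` (SIGMA g:?B. tableaux g \<alpha>) \<subseteq> tableaux f (\<alpha> @ [a])"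
      using add_strip_tableaux(1)[OF f] by auto
  qed
  then have "card (tableaux f (\<alpha> @ [a])) = card (SIGMA g:?B. tableaux g \<alpha>)"
    by (rule bij_betw_same_card)
  also have "\<dots> = (\<Sum>g\<in>?B. card (tableaux g \<alpha>))"
  proof (rule card_SigmaI)
    show "finite ?B" by (rule finite_subset[OF _ finite_interlace[OF f]]) auto
    show "\<forall>g\<in>?B. finite (tableaux g \<alpha>)"
      using finite_tableaux shape_interlace[OF f] by blast
  qed
  finally show ?thesis .
qed

section \<open>Points of a box with prescribed coordinate sum\<close>

text \<open>The case of equal distances from \<open>C / 2\<close> gives the symmetry.\<close>

definition symmetric_unimodal :: "(int \<Rightarrow> nat) \<Rightarrow> int \<Rightarrow> bool" where
  "symmetric_unimodal N C \<longleftrightarrow> (\<forall>s s'. \<bar>2 * s' - C\<bar> \<le> \<bar>2 * s - C\<bar> \<longrightarrow> N s \<le> N s')"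

text \<open>Moving the window by one exchanges a single term, and the distances of the old and the
  new argument from the centre decide which is larger. Reflecting the window gives the
  symmetry.\<close>

lemma symmetric_unimodal_window_sum:
  fixes u v :: int
  assumes N: "symmetric_unimodal N C" and uv: "u \<le> v"
  shows "symmetric_unimodal (\<lambda>s. \<Sum>x\<in>{u..v}. N (s - x)) (C + u + v)"
proof -
  define N' where "N' s = (\<Sum>x\<in>{u..v}. N (s - x))" for s
  define D where "D = C + u + v"
  have N_mono: "N s \<le> N s'" if "\<bar>2 * s' - C\<bar> \<le> \<bar>2 * s - C\<bar>" for s s'
    using N that by (simp add: symmetric_unimodal_def)
  have N_sym: "N (C - s) = N s" for s
    by (rule antisym; rule N_mono; simp add: abs_if)
  have sym: "N' (D - s) = N' s" for s
  proof -
    have "N' (D - s) = (\<Sum>x\<in>{u..v}. N (C - (D - s - (u + v - x))))"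
      unfolding N'_def
      by (rule sum.reindex_bij_witness[of _ "\<lambda>x. u + v - x" "\<lambda>x. u + v - x"])
        (auto simp: N_sym)
    also have "\<dots> = N' s"
      unfolding N'_def by (rule sum.cong) (auto simp: D_def algebra_simps)
    finally show ?thesis .
  qed
  \<comment> \<open>Passing to \<open>s + 1\<close> replaces the term \<open>N (s - v)\<close> by
    \<open>N (s - (u - 1))\<close>, whose argument is no farther from \<open>C / 2\<close> as long
    as \<open>2 * s + 1 \<le> D\<close>.\<close>
  have step: "N' s \<le> N' (s + 1)" if s: "2 * s + 1 \<le> D" for s
  proof -
    have "N' (s + 1) = (\<Sum>y\<in>{u - 1..v - 1}. N (s - y))"
      unfolding N'_def
      by (rule sum.reindex_bij_witness[of _ "\<lambda>y. y + 1" "\<lambda>x. x - 1"]) (auto simp: algebra_simps)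
    also have "{u - 1..v - 1} = insert (u - 1) {u..v - 1}" using uv by auto
    also have "(\<Sum>y\<in>\<dots>. N (s - y)) = N (s - (u - 1)) + (\<Sum>y\<in>{u..v - 1}. N (s - y))" by simp
    finally have 1: "N' (s + 1) = N (s - (u - 1)) + (\<Sum>y\<in>{u..v - 1}. N (s - y))" .
    have "{u..v} = insert v {u..v - 1}" using uv by auto
    then have 2: "N' s = N (s - v) + (\<Sum>y\<in>{u..v - 1}. N (s - y))" unfolding N'_def by simp
    have "N (s - v) \<le> N (s - (u - 1))"
      by (rule N_mono) (use s uv in \<open>simp add: D_def\<close>)
    then show ?thesis using 1 2 by simp
  qed
  have mono: "N' s \<le> N' s'" if "s \<le> s'" "2 * s' \<le> D" for s s'
    using that
  proof (induction s' rule: int_ge_induct)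
    case (step t)
    then show ?case using \<open>\<And>s. 2 * s + 1 \<le> D \<Longrightarrow> N' s \<le> N' (s + 1)\<close>[of t] by simp
  qed simp
  have "N' s \<le> N' s'" if "\<bar>2 * s' - D\<bar> \<le> \<bar>2 * s - D\<bar>" for s s'
  proof -
    \<comment> \<open>Both arguments are reflected into the left half, where \<open>N'\<close> is
      monotone.\<close>
    have "N' (min t (D - t)) = N' t" for t by (simp add: min_def sym)
    moreover have "N' (min s (D - s)) \<le> N' (min s' (D - s'))"
      by (rule mono) (use that in \<open>simp_all add: min_def abs_if split: if_splits\<close>)
    ultimately show ?thesis by simp
  qed
  then show ?thesis by (simp add: symmetric_unimodal_def N'_def D_def)
qed

text \<open>Each further coordinate turns the count into a window sum of the previous one. The sum
  \<open>s\<close> is an integer because \<open>s - y\<close> may be negative; the sum of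
  \<open>lo i + hi i\<close> is twice the centre.\<close>

lemma box_count_symmetric_unimodal:
  fixes lo hi :: "'a \<Rightarrow> nat"
  assumes "finite I"
  shows "symmetric_unimodal (\<lambda>s. card {x \<in> PiE I (\<lambda>i. {lo i..hi i}). int (sum x I) = s})
    (int (\<Sum>i\<in>I. lo i + hi i))"
  using assms
proof (induction I rule: finite_induct)
  case empty
  have "{x \<in> PiE {} (\<lambda>i. {lo i..hi i}). int (sum x {}) = s} = (if s = 0 then {\<lambda>_. undefined} else {})"
    for s by auto
  then show ?case by (simp add: symmetric_unimodal_def)
next
  case (insert a I)
  let ?P = "\<lambda>I s. {x \<in> PiE I (\<lambda>i. {lo i..hi i}). int (sum x I) = s}"
  have fin: "finite (?P I s)" for s
    using insert(1) by (auto intro!: finite_subset[OF _ finite_PiE[of I "\<lambda>i. {lo i..hi i}"]])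
  show ?case
  proof (cases "lo a \<le> hi a")
    \<comment> \<open>An empty range makes the box empty and all counts zero; the window sum lemma
      requires a nonempty window.\<close>
    case False
    then have "PiE (insert a I) (\<lambda>i. {lo i..hi i}) = {}" by (auto simp: PiE_insert_eq)
    then show ?thesis unfolding symmetric_unimodal_def by simp
  next
    case True
    have "card (?P (insert a I) s) = (\<Sum>y\<in>{int (lo a)..int (hi a)}. card (?P I (s - y)))" for s
    proof -
      have "bij_betw (\<lambda>x. (x a, restrict x I)) (?P (insert a I) s)
        (SIGMA y:{lo a..hi a}. ?P I (s - int y))"
      proof (rule bij_betw_byWitness[where f' = "\<lambda>(y, x). x(a := y)"])
        show "\<forall>x\<in>?P (insert a I) s. (\<lambda>(y, x). x(a := y)) (x a, restrict x I) = x"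
          by (auto simp: fun_eq_iff PiE_iff extensional_def)
        show "\<forall>p\<in>SIGMA y:{lo a..hi a}. ?P I (s - int y).
            (\<lambda>x. (x a, restrict x I)) ((\<lambda>(y, x). x(a := y)) p) = p"
          using insert(2) by (auto simp: fun_eq_iff PiE_iff extensional_def)
        show "(\<lambda>x. (x a, restrict x I)) ` ?P (insert a I) s
            \<subseteq> (SIGMA y:{lo a..hi a}. ?P I (s - int y))"
          using insert(1,2) by (auto simp: PiE_iff)
        have "int (\<Sum>i\<in>insert a I. (x(a := y)) i) = int y + int (sum x I)" for x y
        proof -
          have "sum (x(a := y)) I = sum x I" using insert(2) by (intro sum.cong) auto
          then show ?thesis using insert(1,2) by simp
        qed
        then show "(\<lambda>(y, x). x(a := y)) ` (SIGMA y:{lo a..hi a}. ?P I (s - int y))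
            \<subseteq> ?P (insert a I) s"
          using insert(2) by (auto simp: PiE_iff extensional_def simp del: of_nat_sum sum.insert)
      qed
      then have "card (?P (insert a I) s) = (\<Sum>y\<in>{lo a..hi a}. card (?P I (s - int y)))"
        using fin by (simp add: bij_betw_same_card)
      also have "\<dots> = (\<Sum>y\<in>{int (lo a)..int (hi a)}. card (?P I (s - y)))"
        by (rule sum.reindex_bij_witness[of _ nat int]) auto
      finally show ?thesis .
    qed
    moreover have "int (\<Sum>i\<in>insert a I. lo i + hi i)
        = int (\<Sum>i\<in>I. lo i + hi i) + int (lo a) + int (hi a)"
      using insert(1,2) by simp
    ultimately show ?thesis
      using symmetric_unimodal_window_sum[OF insert(3), of "int (lo a)" "int (hi a)"] True by simp
  qed
qed

section \<open>Balancing the weight\<close>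

text \<open>The shapes between \<open>f\<close> and \<open>h\<close> form a box whose opposite corners have total size
  \<open>\<bar>f\<bar> + \<bar>h\<bar>\<close>, because \<open>max x y + min x y = x + y\<close>.\<close>

lemma card_between_mono:
  assumes f: "shape L f" and h: "shape L h"
    and ab: "a + b = a' + b'" "\<bar>int a' - int b'\<bar> \<le> \<bar>int a - int b\<bar>"
    and sz: "sum h {1..L} + a + b = sum f {1..L}"
  shows "card {g. interlace f g \<and> interlace g h \<and> sum g {1..L} + b = sum f {1..L}}
    \<le> card {g. interlace f g \<and> interlace g h \<and> sum g {1..L} + b' = sum f {1..L}}"
proof -
  \<comment> \<open>Row \<open>i\<close> of \<open>g\<close> must satisfy
    \<open>f (Suc i) \<le> g i \<le> f i\<close> and \<open>h i \<le> g i\<close>, and also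
    \<open>g i \<le> h (i - 1)\<close> unless \<open>i = 1\<close>, where \<open>h\<close> gives no
    upper bound.\<close>
  define lo where "lo i = max (f (Suc i)) (h i)" for i
  define hi where "hi i = (if i = 1 then f 1 else min (f i) (h (i - 1)))" for i
  let ?B = "\<lambda>b. {g. interlace f g \<and> interlace g h \<and> sum g {1..L} + b = sum f {1..L}}"
  let ?P = "\<lambda>s. {x \<in> PiE {1..L} (\<lambda>i. {lo i..hi i}). int (sum x {1..L}) = s}"
  have corners: "(\<Sum>i=1..L. lo i + hi i) = sum f {1..L} + sum h {1..L}"
  proof -
    \<comment> \<open>The maximum in \<open>lo K\<close> and the minimum in
      \<open>hi (Suc K)\<close> involve the same two numbers, so they are paired across rows. The
      leftover minimum vanishes at \<open>K = L\<close> since \<open>f (Suc L) = 0\<close>.\<close>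
    have "(\<Sum>i=1..K. lo i + hi i) + min (f (Suc K)) (h K) = sum f {1..Suc K} + sum h {1..K}"
      if "1 \<le> K" for K
      using that
    proof (induction K rule: dec_induct)
      case base
      show ?case by (simp add: lo_def hi_def)
    next
      case (step K)
      have "lo (Suc K) + min (f (Suc (Suc K))) (h (Suc K)) = f (Suc (Suc K)) + h (Suc K)"
        by (simp add: lo_def)
      moreover have "hi (Suc K) = min (f (Suc K)) (h K)" using step by (simp add: hi_def)
      ultimately show ?case using step by simp
    qed
    from this[of L] show ?thesis using f by (cases "L = 0") (auto simp: shape_def)
  qed
  have box: "interlace f g \<and> interlace g h \<longleftrightarrow> g 0 = 0 \<and> (\<forall>i\<ge>1. lo i \<le> g i \<and> g i \<le> hi i)" for g
  proof -
    have "h 0 = 0" using h by (simp add: shape_def)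
    moreover have "(\<forall>i\<ge>1. g (Suc i) \<le> h i) \<longleftrightarrow> (\<forall>i\<ge>1. i \<noteq> 1 \<longrightarrow> g i \<le> h (i - 1))"
      by (metis One_nat_def Suc_le_mono Suc_pred diff_Suc_1 le_0_eq le_SucI not_less_eq_eq not_gr_zero old.nat.distinct(1) less_eq_Suc_le)
    ultimately show ?thesis
      unfolding interlace_def lo_def hi_def by (auto split: if_splits)
  qed
  have card_B: "card (?B b) = card (?P (int (sum f {1..L}) - int b))" for b
  proof -
    let ?F = "\<lambda>g. restrict g {1..L}" and ?G = "\<lambda>x i. if i \<in> {1..L} then x i else 0 :: nat"
    \<comment> \<open>Beyond row \<open>L\<close> the bounds force \<open>g i = 0\<close>, so
      restricting to \<open>{1..L}\<close> is a bijection.\<close>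
    have out: "lo i = 0" "hi i = 0" if "i > L" "i \<ge> 1" for i
      using that f h by (auto simp: lo_def hi_def shape_def)
    have bij: "bij_betw ?F (?B b) (?P (int (sum f {1..L}) - int b))"
    proof (rule bij_betw_byWitness[where f' = ?G])
      show "\<forall>g\<in>?B b. ?G (?F g) = g"
      proof
        fix g assume "g \<in> ?B b"
        then have "shape L g" using shape_interlace[OF f] by blast
        then show "?G (?F g) = g" by (auto simp: fun_eq_iff shape_def not_le)
      qed
      show "\<forall>x\<in>?P (int (sum f {1..L}) - int b). ?F (?G x) = x"
        by (auto simp: fun_eq_iff PiE_iff extensional_def)
      show "?F ` ?B b \<subseteq> ?P (int (sum f {1..L}) - int b)"
      proof (rule image_subsetI)
        fix g assume g: "g \<in> ?B b"
        then have "\<forall>i\<ge>1. lo i \<le> g i \<and> g i \<le> hi i" using box by blast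
        moreover have "int (sum g {1..L}) = int (sum f {1..L}) - int b"
          using g by (simp only: mem_Collect_eq) linarith
        ultimately show "?F g \<in> ?P (int (sum f {1..L}) - int b)"
          by (simp add: PiE_iff del: of_nat_sum)
      qed
      show "?G ` ?P (int (sum f {1..L}) - int b) \<subseteq> ?B b"
      proof
        fix g assume "g \<in> ?G ` ?P (int (sum f {1..L}) - int b)"
        then obtain x where x: "x \<in> ?P (int (sum f {1..L}) - int b)" and g: "g = ?G x" by blast
        have "g 0 = 0 \<and> (\<forall>i\<ge>1. lo i \<le> g i \<and> g i \<le> hi i)"
          using x out by (auto simp: g PiE_iff)
        moreover have "sum g {1..L} = sum x {1..L}" by (simp add: g)
        then have "int (sum g {1..L}) = int (sum f {1..L}) - int b" using x by simp
        then have "sum g {1..L} + b = sum f {1..L}" by linarith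
        ultimately show "g \<in> ?B b" using box by blast
      qed
    qed
    show ?thesis by (rule bij_betw_same_card[OF bij])
  qed
  have "card (?P (int (sum f {1..L}) - int b)) \<le> card (?P (int (sum f {1..L}) - int b'))"
  proof -
    have "\<bar>2 * (int F - int b') - int (F + H)\<bar> \<le> \<bar>2 * (int F - int b) - int (F + H)\<bar>"
      if F: "H + a + b = F" for F H
    proof -
      \<comment> \<open>The coordinate sum is \<open>F - b\<close> and twice the centre is
        \<open>F + H\<close>, so the doubled distance from the centre is the difference of the two
        weights.\<close>
      have "2 * (int F - int b') - int (F + H) = int a' - int b'"
        "2 * (int F - int b) - int (F + H) = int a - int b"
        using ab(1) F by presburger+
      then show ?thesis using ab(2) by simp
    qed
    from this[OF sz] show ?thesis
      using box_count_symmetric_unimodal[of "{1..L}" lo hi]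
      unfolding symmetric_unimodal_def corners by blast
  qed
  then show ?thesis by (simp only: card_B)
qed

text \<open>The branching rule is applied twice and the sums are exchanged, so that the intermediate
  shapes are counted separately for each inner shape \<open>h\<close>. The range of \<open>h\<close>
  depends on \<open>a\<close> and \<open>b\<close> only through \<open>a + b\<close>.\<close>

lemma card_tableaux_append_two:
  assumes f: "shape L f"
  shows "card (tableaux f (\<alpha> @ [a, b])) =
    (\<Sum>h | shape L h \<and> (\<forall>i. h i \<le> f i) \<and> sum h {1..L} + a + b = sum f {1..L}.
      card {g. interlace f g \<and> interlace g h \<and> sum g {1..L} + b = sum f {1..L}} * card (tableaux h \<alpha>))"
proof -
  let ?G = "{g. interlace f g \<and> sum g {1..L} + b = sum f {1..L}}"
  let ?H = "{h. shape L h \<and> (\<forall>i. h i \<le> f i) \<and> sum h {1..L} + a + b = sum f {1..L}}"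
  have finG: "finite ?G" by (rule finite_subset[OF _ finite_interlace[OF f]]) auto
  have finH: "finite ?H"
  proof (rule finite_subset)
    show "?H \<subseteq> (\<lambda>x i. if i \<in> {1..L} then x i else 0) ` (PiE {1..L} (\<lambda>i. {..f i}))"
    proof
      fix h assume h: "h \<in> ?H"
      then have "h = (\<lambda>i. if i \<in> {1..L} then restrict h {1..L} i else 0)"
        by (auto simp: fun_eq_iff shape_def not_le)
      moreover have "restrict h {1..L} \<in> PiE {1..L} (\<lambda>i. {..f i})" using h by auto
      ultimately show "h \<in> (\<lambda>x i. if i \<in> {1..L} then x i else 0) ` (PiE {1..L} (\<lambda>i. {..f i}))"
        by blast
    qed
  qed (intro finite_imageI finite_PiE; simp)
  have "card (tableaux f (\<alpha> @ [a, b])) = (\<Sum>g\<in>?G. card (tableaux g (\<alpha> @ [a])))"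
    using card_tableaux_append_last[OF f, of "\<alpha> @ [a]" b] by simp
  also have "\<dots> = (\<Sum>g\<in>?G. \<Sum>h\<in>{h \<in> ?H. interlace g h}. card (tableaux h \<alpha>))"
  proof (rule sum.cong)
    fix g assume g: "g \<in> ?G"
    then have sg: "shape L g" using shape_interlace[OF f] by blast
    have "h i \<le> f i" if "interlace g h" for h i
      using that g by (cases "i = 0") (auto simp: interlace_def intro: le_trans[of _ "g i"])
    then have "{h. interlace g h \<and> sum h {1..L} + a = sum g {1..L}} = {h \<in> ?H. interlace g h}"
      using g shape_interlace[OF sg] by auto
    then show "card (tableaux g (\<alpha> @ [a])) = (\<Sum>h\<in>{h \<in> ?H. interlace g h}. card (tableaux h \<alpha>))"
      by (simp add: card_tableaux_append_last[OF sg])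
  qed simp
  also have "\<dots> = (\<Sum>h\<in>?H. \<Sum>g\<in>{g \<in> ?G. interlace g h}. card (tableaux h \<alpha>))"
    by (rule sum.swap_restrict[OF finG finH])
  also have "\<dots> = (\<Sum>h\<in>?H. card {g. interlace f g \<and> interlace g h \<and> sum g {1..L} + b = sum f {1..L}}
      * card (tableaux h \<alpha>))"
    by (simp add: conj_commute conj_left_commute)
  finally show ?thesis .
qed

text \<open>The branching rule strips the letters after the pair one by one; once the pair is last,
  the comparison holds for each inner shape.\<close>

lemma card_tableaux_balance_adjacent:
  assumes "shape L f" and ab: "a + b = a' + b'" "\<bar>int a' - int b'\<bar> \<le> \<bar>int a - int b\<bar>"
  shows "card (tableaux f (\<alpha> @ a # b # \<gamma>)) \<le> card (tableaux f (\<alpha> @ a' # b' # \<gamma>))"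
  using assms(1)
proof (induction \<gamma> arbitrary: f rule: rev_induct)
  case Nil
  have "card (tableaux f (\<alpha> @ [a, b])) \<le> card (tableaux f (\<alpha> @ [a', b']))"
    \<comment> \<open>Rewriting \<open>a + b\<close> to \<open>a' + b'\<close> makes the two outer
      index sets equal.\<close>
    unfolding card_tableaux_append_two[OF Nil] add.assoc ab(1)
    by (intro sum_mono mult_right_mono card_between_mono[OF Nil _ ab]) (use ab in auto)
  then show ?case by simp
next
  case (snoc c \<gamma>)
  have "card (tableaux f ((\<alpha> @ a # b # \<gamma>) @ [c])) \<le> card (tableaux f ((\<alpha> @ a' # b' # \<gamma>) @ [c]))"
    unfolding card_tableaux_append_last[OF snoc.prems]
    by (intro sum_mono snoc.IH) (use shape_interlace[OF snoc.prems] in auto)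
  then show ?case by simp
qed

text \<open>A swap leaves the absolute difference unchanged, so the adjacent comparison holds in
  both directions; \<open>x\<close> passes the entries of \<open>\<beta>\<close> one at a
  time.\<close>

lemma card_tableaux_move:
  assumes f: "shape L f"
  shows "card (tableaux f (\<alpha> @ \<beta> @ x # \<gamma>)) = card (tableaux f (\<alpha> @ x # \<beta> @ \<gamma>))"
proof (induction \<beta> arbitrary: \<alpha>)
  case (Cons y \<beta>)
  have "card (tableaux f (\<alpha> @ y # x # (\<beta> @ \<gamma>))) = card (tableaux f (\<alpha> @ x # y # (\<beta> @ \<gamma>)))"
    by (rule antisym; rule card_tableaux_balance_adjacent[OF f]) auto
  then show ?case using Cons[of "\<alpha> @ [y]"] by simp
qed simp

text \<open>The prefix \<open>\<alpha>\<close> collects the entries already in place during the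
  induction.\<close>

lemma card_tableaux_permute:
  assumes f: "shape L f" and "mset \<beta> = mset \<gamma>"
  shows "card (tableaux f (\<alpha> @ \<beta>)) = card (tableaux f (\<alpha> @ \<gamma>))"
  using assms(2)
proof (induction \<beta> arbitrary: \<alpha> \<gamma>)
  case (Cons x \<beta>)
  then have "x \<in> set \<gamma>" by (metis list.set_intros(1) set_mset_mset)
  then obtain us vs where \<gamma>: "\<gamma> = us @ x # vs" by (meson split_list)
  then have "mset \<beta> = mset (us @ vs)" using Cons.prems by simp
  from Cons.IH[OF this, of "\<alpha> @ [x]"] show ?case
    using card_tableaux_move[OF f, of \<alpha> us x vs] \<gamma> by simp
qed simp

text \<open>Only the minimum \<open>q\<close> and \<open>Suc q\<close> can occur.\<close>

lemma mset_beta_if_balanced: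
  assumes "\<gamma> \<noteq> []" and bal: "\<And>x y. x \<in> set \<gamma> \<Longrightarrow> y \<in> set \<gamma> \<Longrightarrow> x \<le> Suc y"
  shows "mset \<gamma> = mset (beta (length \<gamma>) (sum_list \<gamma>))"
proof -
  define q where "q = Min (set \<gamma>)"
  have qin: "q \<in> set \<gamma>" using assms(1) by (simp add: q_def)
  have vals: "x = q \<or> x = Suc q" if "x \<in> set \<gamma>" for x
    using bal[OF that qin] that by (auto simp: q_def le_Suc_eq intro!: antisym)
  define c where "c = count (mset \<gamma>) (Suc q)"
  define d where "d = count (mset \<gamma>) q"
  have ms: "mset \<gamma> = replicate_mset c (Suc q) + replicate_mset d q"
  proof (rule multiset_eqI)
    fix x show "count (mset \<gamma>) x = count (replicate_mset c (Suc q) + replicate_mset d q) x"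
      using vals[of x] by (cases "x \<in> set \<gamma>") (auto simp: c_def d_def)
  qed
  have len: "length \<gamma> = c + d" using arg_cong[OF ms, of size] by simp
  have "sum_list \<gamma> = sum_mset (mset \<gamma>)" by (simp add: sum_mset_sum_list)
  also have "\<dots> = (c + d) * q + c" by (simp add: ms algebra_simps)
  finally have sum: "sum_list \<gamma> = (c + d) * q + c" .
  \<comment> \<open>Since \<open>q\<close> occurs, \<open>c\<close> is less than the length, so it
    is the remainder and \<open>q\<close> the quotient.\<close>
  have "d > 0" using qin by (simp add: d_def)
  then have "sum_list \<gamma> div length \<gamma> = q" by (simp add: sum len)
  then show ?thesis by (simp add: beta_def ms sum len algebra_simps)
qed

text \<open>Moving one unit from a part to another that is smaller by at least 2 lowers the sum of
  squares and does not lower the count; this ends at a balanced weight.\<close>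

lemma card_tableaux_le_beta:
  assumes f: "shape L f" and "\<gamma> \<noteq> []"
  shows "card (tableaux f \<gamma>) \<le> card (tableaux f (beta (length \<gamma>) (sum_list \<gamma>)))"
  using assms(2)
proof (induction "\<Sum>x\<leftarrow>\<gamma>. x ^ 2" arbitrary: \<gamma> rule: less_induct)
  case less
  show ?case
  proof (cases "\<forall>x\<in>set \<gamma>. \<forall>y\<in>set \<gamma>. x \<le> Suc y")
    case True
    then show ?thesis
      using card_tableaux_permute[OF f mset_beta_if_balanced[OF less.prems], of "[]"] by simp
  next
    case False
    then obtain x y where xy: "x \<in># mset \<gamma>" "y \<in># mset \<gamma>" "Suc y < x" by (auto simp: not_le)
    then have "y \<in># mset \<gamma> - {#x#}" by (simp add: in_diff_count)
    then obtain A where "mset \<gamma> - {#x#} = add_mset y A" by (meson mset_add)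
    then have "mset \<gamma> = add_mset x (add_mset y A)" using xy(1) by (metis insert_DiffM)
    moreover obtain \<delta> where "mset \<delta> = A" using ex_mset by blast
    ultimately have ms: "mset \<gamma> = mset (x # y # \<delta>)" by simp
    let ?\<gamma> = "(x - 1) # (y + 1) # \<delta>"
    have len: "length ?\<gamma> = length \<gamma>" using mset_eq_length[OF ms] by simp
    have "sum_list \<gamma> = sum_list (x # y # \<delta>)" using ms by (metis sum_mset_sum_list)
    then have sum: "sum_list ?\<gamma> = sum_list \<gamma>" using xy(3) by simp
    have "(\<Sum>z\<leftarrow>\<gamma>. z ^ 2) = (\<Sum>z\<leftarrow>x # y # \<delta>. z ^ 2)"
      using ms by (metis mset_map sum_mset_sum_list)
    moreover obtain e where "x = Suc (Suc (y + e))" using xy(3) less_iff_Suc_add by auto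
    ultimately have "(\<Sum>z\<leftarrow>?\<gamma>. z ^ 2) < (\<Sum>z\<leftarrow>\<gamma>. z ^ 2)"
      by (simp add: power2_eq_square algebra_simps)
    from less.hyps[OF this] have "card (tableaux f ?\<gamma>) \<le> card (tableaux f (beta (length \<gamma>) (sum_list \<gamma>)))"
      unfolding len sum by simp
    moreover have "card (tableaux f \<gamma>) = card (tableaux f (x # y # \<delta>))"
      using card_tableaux_permute[OF f ms, of "[]"] by simp
    moreover have "card (tableaux f (x # y # \<delta>)) \<le> card (tableaux f ?\<gamma>)"
      using card_tableaux_balance_adjacent[OF f, of x y "x - 1" "y + 1" "[]" \<delta>] xy(3) by simp
    ultimately show ?thesis by simp
  qed
qed


section \<open>Removing a row or a column\<close>

text \<open>A sorted list is determined by its multiset.\<close>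

lemma nondecreasing_eq_if_same_counts:
  fixes u v :: "nat \<Rightarrow> nat"
  assumes u: "\<And>i j. 1 \<le> i \<Longrightarrow> i < j \<Longrightarrow> j \<le> p \<Longrightarrow> u i \<le> u j"
    and v: "\<And>i j. 1 \<le> i \<Longrightarrow> i < j \<Longrightarrow> j \<le> p \<Longrightarrow> v i \<le> v j"
    and cnt: "\<And>k. card {j \<in> {1..p}. u j = k} = card {j \<in> {1..p}. v j = k}"
    and j: "j \<in> {1..p}"
  shows "u j = v j"
proof -
  let ?xs = "[1..<Suc p]"
  have count: "count (mset (map w ?xs)) k = card {j \<in> {1..p}. w j = k}" for w :: "nat \<Rightarrow> nat" and k
  proof -
    have "mset ?xs = mset_set {1..p}"
      by (metis atLeastLessThanSuc_atLeastAtMost mset_upt)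
    moreover have "w -` {k} \<inter> {1..p} = {j \<in> {1..p}. w j = k}" by auto
    ultimately show ?thesis by (simp add: count_image_mset)
  qed
  have sorted: "sorted (map w ?xs)"
    if "\<And>i j. 1 \<le> i \<Longrightarrow> i < j \<Longrightarrow> j \<le> p \<Longrightarrow> w i \<le> w j" for w :: "nat \<Rightarrow> nat"
    using that by (auto simp: sorted_iff_nth_mono_less simp del: upt_Suc)
  have "mset (map u ?xs) = mset (map v ?xs)"
    by (rule multiset_eqI) (simp only: count cnt)
  moreover have "sorted (map u ?xs)" "sorted (map v ?xs)"
    using u v by (intro sorted; blast)+
  ultimately have "map u ?xs = map v ?xs"
    by (metis properties_for_sort)
  then have "\<forall>i\<in>set ?xs. u i = v i" by (simp only: map_eq_conv)
  moreover have "j \<in> set ?xs" using j by auto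
  ultimately show ?thesis by blast
qed

text \<open>Subtracting the letters on \<open>E\<close> from the weight gives the letters on the
  line, and monotonicity along the line fixes their order.\<close>

lemma tableaux_eqI:
  fixes line :: "nat \<Rightarrow> nat \<times> nat"
  assumes f: "shape L f" and T: "T \<in> tableaux f \<alpha>" "T' \<in> tableaux f \<alpha>"
    and D: "diagram f = E \<union> line ` {1..p}" "E \<inter> line ` {1..p} = {}" "inj_on line {1..p}"
    and mono: "\<And>U i j. tableau f U \<Longrightarrow> 1 \<le> i \<Longrightarrow> i < j \<Longrightarrow> j \<le> p \<Longrightarrow> U (line i) \<le> U (line j)"
    and E: "\<And>c. c \<in> E \<Longrightarrow> T c = T' c"
  shows "T = T'"
proof -
  have tab: "tableau f T" "tableau f T'" using T by (simp_all add: tableaux_def)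
  have finE: "finite E" using finite_diagram[OF f] D(1) by simp
  have split: "card {c \<in> diagram f. U c = k} = card {c \<in> E. U c = k} + card {j \<in> {1..p}. U (line j) = k}"
    for U k
  proof -
    have "{c \<in> diagram f. U c = k} = {c \<in> E. U c = k} \<union> line ` {j \<in> {1..p}. U (line j) = k}"
      unfolding D(1) by auto
    moreover have "card (line ` {j \<in> {1..p}. U (line j) = k}) = card {j \<in> {1..p}. U (line j) = k}"
      by (rule card_image) (rule inj_on_subset[OF D(3)], auto)
    moreover have "card ({c \<in> E. U c = k} \<union> line ` {j \<in> {1..p}. U (line j) = k})
        = card {c \<in> E. U c = k} + card (line ` {j \<in> {1..p}. U (line j) = k})"
    proof (rule card_Un_disjoint)
      show "{c \<in> E. U c = k} \<inter> line ` {j \<in> {1..p}. U (line j) = k} = {}"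
        using D(2) by blast
      show "finite {c \<in> E. U c = k}" using finE by simp
      show "finite (line ` {j \<in> {1..p}. U (line j) = k})"
        by (rule finite_imageI, rule finite_subset[of _ "{1..p}"]) auto
    qed
    ultimately show ?thesis by simp
  qed
  have all_counts: "card {c \<in> diagram f. T c = k} = card {c \<in> diagram f. T' c = k}" for k
  \<comment> \<open>The weight condition starts at letter 1; letter 0 never occurs in a
    tableau.\<close>
  proof (cases "k = 0")
    case True
    then have "{c \<in> diagram f. U c = k} = {}" if "tableau f U" for U
      using tableau_pos[OF that] by fastforce
    then show ?thesis by (simp only: tab)
  qed (use T in \<open>simp add: tableaux_def\<close>)
  have "{c \<in> E. T c = k} = {c \<in> E. T' c = k}" for k using E by auto
  then have "card {j \<in> {1..p}. T (line j) = k} = card {j \<in> {1..p}. T' (line j) = k}" for k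
    using all_counts[of k] unfolding split by simp
  then have "T (line j) = T' (line j)" if "j \<in> {1..p}" for j
    using nondecreasing_eq_if_same_counts[of p "\<lambda>j. T (line j)" "\<lambda>j. T' (line j)"]
      mono[OF tab(1)] mono[OF tab(2)] that by blast
  then have "T c = T' c" if "c \<in> diagram f" for c
    using that E unfolding D(1) by blast
  moreover have "T \<in> extensional (diagram f)" "T' \<in> extensional (diagram f)"
    using tab by (auto simp: tableau_def PiE_iff)
  ultimately show "T = T'" by (intro extensionalityI)
qed

text \<open>Both sides count the cells, on the left grouped by letter.\<close>

lemma sum_list_weight:
  assumes g: "shape L g" and S: "S \<in> tableaux g \<alpha>"
  shows "sum_list \<alpha> = sum g {1..L}"
proof -
  have "sum g {1..L} = (\<Sum>c\<in>diagram g. 1)" by (simp add: card_diagram[OF g])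
  also have "\<dots> = (\<Sum>k\<in>{1..length \<alpha>}. \<Sum>c\<in>{c \<in> diagram g. S c = k}. 1)"
    by (rule sum.group[symmetric])
      (use finite_diagram[OF g] tableaux_entry_bounds[OF g S] in auto)
  also have "\<dots> = (\<Sum>k\<in>{1..length \<alpha>}. part \<alpha> k)"
    using S by (intro sum.cong) (simp_all add: tableaux_def)
  also have "\<dots> = (\<Sum>k\<in>{0..<length \<alpha>}. \<alpha> ! k)"
    by (rule sum.reindex_bij_witness[of _ Suc "\<lambda>k. k - 1"]) (auto simp: Defs.part_def)
  finally show ?thesis by (simp add: sum_list_sum_nth)
qed

text \<open>A sequence corresponds to the left-justified subset of an \<open>m\<close> by
  \<open>l\<close> array with row lengths \<open>\<gamma> ! i\<close>, which is one of the
  \<open>r\<close>-subsets of an \<open>m * l\<close>-set.\<close>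

lemma
  fixes m l r :: nat
  defines "G \<equiv> {\<gamma>. length \<gamma> = m \<and> set \<gamma> \<subseteq> {..l} \<and> sum_list \<gamma> = r}"
  shows finite_bounded_compositions: "finite G"
    and card_bounded_compositions_le: "card G \<le> (m * l choose r)"
proof -
  show "finite G"
    by (rule finite_subset[OF _ finite_lists_length_eq[of "{..l}" m]]) (auto simp: G_def)
  let ?F = "\<lambda>\<gamma>. SIGMA i:{..<m}. {..<\<gamma> ! i}"
  let ?S = "{B. B \<subseteq> {..<m} \<times> {..<l} \<and> card B = r}"
  have "inj_on ?F G"
  proof (rule inj_onI)
    fix \<gamma> \<delta> assume *: "\<gamma> \<in> G" "\<delta> \<in> G" "?F \<gamma> = ?F \<delta>"
    show "\<gamma> = \<delta>"
    proof (rule nth_equalityI)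
      show "length \<gamma> = length \<delta>" using * by (simp add: G_def)
      fix i assume "i < length \<gamma>"
      then have "i < m" using * by (simp add: G_def)
      then have "{..<\<gamma> ! i} = {..<\<delta> ! i}" using *(3) by (auto simp: set_eq_iff)
      then show "\<gamma> ! i = \<delta> ! i" by simp
    qed
  qed
  moreover have "?F ` G \<subseteq> ?S"
  proof (rule image_subsetI)
    fix \<gamma> assume \<gamma>: "\<gamma> \<in> G"
    then have "\<gamma> ! i \<le> l" if "i < m" for i
      using that nth_mem[of i \<gamma>] \<gamma> unfolding G_def by blast
    then have "?F \<gamma> \<subseteq> {..<m} \<times> {..<l}" by fastforce
    moreover have "card (?F \<gamma>) = sum_list \<gamma>"
      using \<gamma> by (simp add: sum_list_sum_nth G_def atLeast0LessThan)
    ultimately show "?F \<gamma> \<in> ?S" using \<gamma> by (simp add: G_def)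
  qed
  moreover have "finite ?S" by (rule finite_subset[of _ "Pow ({..<m} \<times> {..<l})"]) auto
  ultimately have "card G \<le> card ?S" by (rule card_inj_on_le)
  also have "\<dots> = (m * l choose r)" by (simp add: n_subsets)
  finally show "card G \<le> (m * l choose r)" .
qed

text \<open>Here \<open>line\<close> enumerates the first row, with \<open>(x, y) = (1, 0)\<close>, or the first column, with \<open>(x, y) = (0, 1)\<close>.\<close>

lemma card_tableaux_le_remove_line:
  fixes line :: "nat \<Rightarrow> nat \<times> nat"
  assumes f: "shape L f" and g: "shape L g" and m: "m \<ge> 1"
    and D: "diagram f = (\<lambda>(i, j). (i + x, j + y)) ` diagram g \<union> line ` {1..p}"
      "(\<lambda>(i, j). (i + x, j + y)) ` diagram g \<inter> line ` {1..p} = {}" "inj_on line {1..p}"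
    and mono: "\<And>U i j. tableau f U \<Longrightarrow> 1 \<le> i \<Longrightarrow> i < j \<Longrightarrow> j \<le> p \<Longrightarrow> U (line i) \<le> U (line j)"
    and r: "r = sum f {1..L} - p"
  shows "card (tableaux f (replicate m l)) \<le> (m * l choose r) * card (tableaux g (beta m r))"
proof -
  define \<sigma> where "\<sigma> = (\<lambda>(i, j). (i + x, j + y :: nat) :: nat \<times> nat)"
  note D = D[folded \<sigma>_def]
  let ?A = "tableaux f (replicate m l)"
  \<comment> \<open>\<open>?\<psi>\<close> removes the line and keeps the remaining entries
    unchanged; \<open>?w\<close> is the resulting weight, with list position \<open>k\<close>
    standing for letter \<open>Suc k\<close>.\<close>
  let ?\<psi> = "\<lambda>T. restrict (T \<circ> \<sigma>) (diagram g)"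
  let ?w = "\<lambda>T. map (\<lambda>k. card {c \<in> diagram g. T (\<sigma> c) = Suc k}) [0..<m]"
  let ?G = "{\<gamma>. length \<gamma> = m \<and> set \<gamma> \<subseteq> {..l} \<and> sum_list \<gamma> = r}"
  have inj: "inj \<sigma>" by (auto simp: \<sigma>_def inj_def)
  have \<sigma>_in: "\<sigma> c \<in> diagram f" if "c \<in> diagram g" for c using that D(1) by auto
  have "sum f {1..L} = sum g {1..L} + p"
  proof -
    have "card (diagram f) = card (\<sigma> ` diagram g) + card (line ` {1..p})"
      unfolding D(1) by (rule card_Un_disjoint) (use finite_diagram[OF g] D(2) in auto)
    moreover have "card (line ` {1..p}) = p" by (subst card_image[OF D(3)]) simp
    ultimately show ?thesis
      by (simp add: card_image[OF inj_on_subset[OF inj]] card_diagram[OF f] card_diagram[OF g])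
  qed
  then have r_eq: "r = sum g {1..L}" using r by simp
  have \<psi>_tab: "?\<psi> T \<in> tableaux g (?w T)" if T: "T \<in> ?A" for T
  proof -
    have tab: "tableau f T" using T by (simp add: tableaux_def)
    have "tableau g (?\<psi> T)"
      unfolding tableau_def
    proof (intro conjI allI impI)
      show "?\<psi> T \<in> diagram g \<rightarrow>\<^sub>E {1..}"
        using tableau_pos[OF tab] \<sigma>_in by (auto simp: PiE_iff)
      fix i j k assume *: "(i, j) \<in> diagram g" "(i, k) \<in> diagram g" "j < k"
      then show "?\<psi> T (i, j) \<le> ?\<psi> T (i, k)"
        using \<sigma>_in[OF *(1)] \<sigma>_in[OF *(2)] tab by (simp add: \<sigma>_def tableau_def)
    next
      fix h i j assume *: "(h, j) \<in> diagram g" "(i, j) \<in> diagram g" "h < i"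
      then show "?\<psi> T (h, j) < ?\<psi> T (i, j)"
        using \<sigma>_in[OF *(1)] \<sigma>_in[OF *(2)] tab by (simp add: \<sigma>_def tableau_def)
    qed
    moreover have "card {c \<in> diagram g. ?\<psi> T c = k} = part (?w T) k" if k: "k \<ge> 1" for k
    proof -
      have eq: "{c \<in> diagram g. ?\<psi> T c = k} = {c \<in> diagram g. T (\<sigma> c) = k}" by auto
      show ?thesis
      proof (cases "k \<le> m")
        case True
        then have "[0..<m] ! (k - 1) = k - 1" using k by (subst nth_upt) auto
        then show ?thesis using True k unfolding eq by (simp add: Defs.part_def)
      next
        case False
        then have "{c \<in> diagram g. T (\<sigma> c) = k} = {}"
          using tableaux_entry_bounds(2)[OF f T \<sigma>_in] by force
        then show ?thesis using False unfolding eq by (simp only: card.empty) (simp add: Defs.part_def)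
      qed
    qed
    ultimately show ?thesis by (simp add: tableaux_def)
  qed
  have w_in: "?w T \<in> ?G" if T: "T \<in> ?A" for T
  proof -
    have "card {c \<in> diagram g. T (\<sigma> c) = Suc k} \<le> l" if "k < m" for k
    proof -
      \<comment> \<open>The shift embeds these cells into the \<open>l\<close> cells of
        \<open>f\<close> carrying the same letter.\<close>
      have "card {c \<in> diagram g. T (\<sigma> c) = Suc k} \<le> card {c \<in> diagram f. T c = Suc k}"
        by (rule card_inj_on_le[of \<sigma>])
          (use inj_on_subset[OF inj] \<sigma>_in finite_diagram[OF f] in auto)
      also have "\<dots> = l" using T that by (simp add: tableaux_def Defs.part_def)
      finally show ?thesis .
    qed
    then show ?thesis using sum_list_weight[OF g \<psi>_tab[OF T]] r_eq by auto
  qed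
  have "inj_on ?\<psi> ?A"
  proof (rule inj_onI)
    fix T T' assume *: "T \<in> ?A" "T' \<in> ?A" "?\<psi> T = ?\<psi> T'"
    have "T c = T' c" if c: "c \<in> \<sigma> ` diagram g" for c
    proof -
      obtain d where "c = \<sigma> d" "d \<in> diagram g" using c by blast
      then show ?thesis using fun_cong[OF *(3), of d] by simp
    qed
    then show "T = T'" using tableaux_eqI[OF f *(1,2) D] mono by blast
  qed
  moreover have "?\<psi> ` ?A \<subseteq> (\<Union>\<gamma>\<in>?G. tableaux g \<gamma>)"
    using \<psi>_tab w_in by blast
  moreover have "finite (\<Union>\<gamma>\<in>?G. tableaux g \<gamma>)"
    using finite_bounded_compositions finite_tableaux[OF g] by blast
  ultimately have "card ?A \<le> card (\<Union>\<gamma>\<in>?G. tableaux g \<gamma>)"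
    by (rule card_inj_on_le)
  also have "\<dots> \<le> (\<Sum>\<gamma>\<in>?G. card (tableaux g \<gamma>))"
    by (rule card_UN_le[OF finite_bounded_compositions])
  also have "\<dots> \<le> (\<Sum>\<gamma>\<in>?G. card (tableaux g (beta m r)))"
  proof (rule sum_mono)
    fix \<gamma> assume "\<gamma> \<in> ?G"
    then show "card (tableaux g \<gamma>) \<le> card (tableaux g (beta m r))"
      using card_tableaux_le_beta[OF g, of \<gamma>] m by force
  qed
  also have "\<dots> = card ?G * card (tableaux g (beta m r))" by simp
  also have "\<dots> \<le> (m * l choose r) * card (tableaux g (beta m r))"
    by (intro mult_right_mono card_bounded_compositions_le) simp
  finally show ?thesis .
qed

section \<open>Conjugation and column deletion in terms of row lengths\<close>

lemma part_Cons: "part (x # \<mu>) (Suc i) = (if i = 0 then x else part \<mu> i)"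
  by (auto simp: Defs.part_def nth_Cons')

lemma part_le_Max: "sorted_wrt (\<ge>) (x # \<mu>) \<Longrightarrow> part (x # \<mu>) i \<le> x"
  by (auto simp: Defs.part_def nth_Cons')

text \<open>In a weakly decreasing list the entries at least \<open>j\<close> form a prefix.\<close>

lemma le_length_filter_iff:
  assumes "sorted_wrt (\<ge>) \<mu>" "1 \<le> i" "1 \<le> j"
  shows "i \<le> length (filter (\<lambda>x. j \<le> x) \<mu>) \<longleftrightarrow> j \<le> part \<mu> i"
  using assms
proof (induction \<mu> arbitrary: i)
  case Nil
  then show ?case by (simp add: Defs.part_def)
next
  case (Cons x \<mu>)
  show ?case
  proof (cases "j \<le> x")
    case True
    obtain i' where "i = Suc i'" using Cons.prems(2) by (cases i) auto
    then show ?thesis using True Cons by (cases "i' = 0") (auto simp: part_Cons)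
  next
    case False
    then have "filter (\<lambda>x. j \<le> x) (x # \<mu>) = []"
      using Cons.prems(1) by (auto simp: filter_empty_conv)
    then show ?thesis using False part_le_Max[OF Cons.prems(1), of i] Cons.prems(2) by simp
  qed
qed

lemma part_conjugate:
  assumes "sorted_wrt (\<ge>) \<mu>" "1 \<le> j"
  shows "part (conjugate \<mu>) j = length (filter (\<lambda>x. j \<le> x) \<mu>)"
proof (cases "j \<le> part \<mu> 1")
  case True
  then have "[1..<part \<mu> 1 + 1] ! (j - 1) = j" using assms(2) by (subst nth_upt) auto
  then show ?thesis using True assms(2)
    unfolding Defs.part_def[of "conjugate \<mu>"] by (simp add: conjugate_def del: upt_Suc)
next
  case False
  then have "length (filter (\<lambda>x. j \<le> x) \<mu>) = 0"
    using le_length_filter_iff[OF assms(1), of 1 j] assms(2) by linarith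
  then show ?thesis using False
    unfolding Defs.part_def[of "conjugate \<mu>"] by (simp add: conjugate_def del: upt_Suc)
qed

text \<open>Conjugation transposes the diagram.\<close>

lemma le_part_conjugate_iff:
  assumes "sorted_wrt (\<ge>) \<mu>" "1 \<le> i" "1 \<le> j"
  shows "i \<le> part (conjugate \<mu>) j \<longleftrightarrow> j \<le> part \<mu> i"
  using le_length_filter_iff[OF assms] part_conjugate[OF assms(1,3)] by simp

lemma sorted_conjugate: "sorted_wrt (\<ge>) (conjugate \<mu>)"
proof -
  have "length (filter (\<lambda>x. k \<le> x) \<mu>) \<le> length (filter (\<lambda>x. j \<le> x) \<mu>)" if "j \<le> k" for j k
    using that by (induction \<mu>) auto
  then show ?thesis
    by (auto simp: conjugate_def sorted_wrt_iff_nth_less simp del: upt_Suc)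
qed

lemma part_tl: "part (tl \<mu>) i = (if i = 0 then 0 else part \<mu> (Suc i))"
  by (cases \<mu>) (auto simp: Defs.part_def nth_Cons')

text \<open>The two conjugations cancel, and the row deleted between them shifts the column index by
  one. Truncated subtraction covers empty rows.\<close>

lemma part_delete_column:
  assumes "sorted_wrt (\<ge>) \<mu>"
  shows "part (delete_column \<mu>) i = part \<mu> i - 1"
proof (cases "i = 0")
  case False
  have s: "sorted_wrt (\<ge>) (tl (conjugate \<mu>))"
    using sorted_conjugate[of \<mu>] by (cases "conjugate \<mu>") auto
  have "j \<le> part (delete_column \<mu>) i \<longleftrightarrow> j \<le> part \<mu> i - 1" if j: "1 \<le> j" for j
  proof -
    have "j \<le> part (delete_column \<mu>) i \<longleftrightarrow> i \<le> part (tl (conjugate \<mu>)) j"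
      using le_part_conjugate_iff[OF s j, of i] False by (simp add: delete_column_def delete_row_def)
    also have "\<dots> \<longleftrightarrow> i \<le> part (conjugate \<mu>) (Suc j)" using j by (simp add: part_tl)
    also have "\<dots> \<longleftrightarrow> Suc j \<le> part \<mu> i"
      using le_part_conjugate_iff[OF assms, of i "Suc j"] False by simp
    finally show ?thesis by auto
  qed
  then show ?thesis
    by (metis One_nat_def Suc_leI le_refl antisym bot_nat_0.not_eq_extremum le0)
qed (simp add: Defs.part_def)

lemma shape_part:
  assumes "sorted_wrt (\<ge>) \<mu>" "length \<mu> \<le> L"
  shows "shape L (part \<mu>)"
proof -
  have "part \<mu> (Suc i) \<le> part \<mu> i" if "1 \<le> i" for i
    using sorted_wrt_nth_less[OF assms(1), of "i - 1" i] that by (simp add: Defs.part_def)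
  then show ?thesis using assms(2) by (simp add: shape_def Defs.part_def)
qed

lemma sum_part: "sum (part \<mu>) {1..length \<mu>} = sum_list \<mu>"
proof -
  have "sum (part \<mu>) {1..length \<mu>} = (\<Sum>i\<in>{0..<length \<mu>}. \<mu> ! i)"
    by (rule sum.reindex_bij_witness[of _ Suc "\<lambda>k. k - 1"]) (auto simp: Defs.part_def)
  then show ?thesis by (simp add: sum_list_sum_nth)
qed

section \<open>The power bound, the vanishing case and the four claims\<close>

text \<open>The weight recovers the first row from the other cells, each of which holds one of
  \<open>length \<alpha>\<close> letters.\<close>

lemma card_tableaux_le_power:
  assumes f: "shape L f"
  shows "card (tableaux f \<alpha>) \<le> length \<alpha> ^ (sum f {1..L} - f 1)"
proof -
  let ?R = "(\<lambda>j. (1 :: nat, j)) ` {1..f 1}"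
  let ?E = "diagram f - ?R"
  have R: "?R \<subseteq> diagram f" by (auto simp: diagram_def)
  have D: "diagram f = ?E \<union> ?R" "?E \<inter> ?R = {}" "inj_on (\<lambda>j. (1 :: nat, j)) {1..f 1}"
    using R by (auto simp: inj_on_def)
  have "card ?R = f 1" by (subst card_image[OF D(3)]) simp
  then have cardE: "card ?E = sum f {1..L} - f 1"
    using card_Diff_subset[OF _ R] by (simp add: card_diagram[OF f])
  have finE: "finite ?E" using finite_diagram[OF f] by simp
  have "inj_on (\<lambda>T. restrict T ?E) (tableaux f \<alpha>)"
  proof (rule inj_onI)
    fix T T' assume *: "T \<in> tableaux f \<alpha>" "T' \<in> tableaux f \<alpha>" "restrict T ?E = restrict T' ?E"
    have "T c = T' c" if "c \<in> ?E" for c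
      using that fun_cong[OF *(3), of c] by (simp only: restrict_apply if_True)
    moreover have "U (1, i) \<le> U (1, j)"
      if "tableau f U" "1 \<le> i" "i < j" "j \<le> f 1" for U i j
      using that by (auto simp: tableau_def diagram_def)
    ultimately show "T = T'" using tableaux_eqI[OF f *(1,2) D] by blast
  qed
  moreover have "(\<lambda>T. restrict T ?E) ` tableaux f \<alpha> \<subseteq> ?E \<rightarrow>\<^sub>E {1..length \<alpha>}"
  proof (rule image_subsetI)
    fix T assume "T \<in> tableaux f \<alpha>"
    from tableaux_entry_bounds[OF f this] show "restrict T ?E \<in> ?E \<rightarrow>\<^sub>E {1..length \<alpha>}"
      by simp
  qed
  moreover have "finite (?E \<rightarrow>\<^sub>E {1..length \<alpha>})" by (intro finite_PiE finE) auto
  ultimately have "card (tableaux f \<alpha>) \<le> card (?E \<rightarrow>\<^sub>E {1..length \<alpha>})"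
    by (rule card_inj_on_le)
  then show ?thesis using finE cardE by (simp add: card_PiE)
qed

text \<open>Strictness down the first column forces its entry in row \<open>i\<close> to be at least
  \<open>i\<close>, too large for the last of \<open>p\<close> rows.\<close>

lemma tableaux_empty_if_long_column:
  assumes f: "shape L f" and "length \<alpha> < p" "1 \<le> f p"
  shows "tableaux f \<alpha> = {}"
proof (rule ccontr)
  assume "tableaux f \<alpha> \<noteq> {}"
  then obtain T where T: "T \<in> tableaux f \<alpha>" by blast
  have cell: "(i, 1) \<in> diagram f" if "1 \<le> i" "i \<le> p" for i
    using shape_antimono[OF f that] assms(3) that by (simp add: diagram_def)
  have "i \<le> T (i, 1)" if "1 \<le> i" "i \<le> p" for i
    using that
  proof (induction i rule: dec_induct)
    case base
    then show ?case using tableaux_entry_bounds(1)[OF f T cell] by simp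
  next
    case (step i)
    then have "T (i, 1) < T (Suc i, 1)"
      using T cell[of i] cell[of "Suc i"] by (auto simp: tableaux_def tableau_def)
    then show ?case using step by simp
  qed
  from this[of p] show False
    using tableaux_entry_bounds(2)[OF f T cell[of p]] assms(2) by simp
qed

theorem lemma2p8:
  fixes m l n r r' :: nat and \<mu> :: "nat list"
  assumes "m \<ge> 2" and "l \<ge> 2" and "n = m * l"
    and "\<mu> \<turnstile> n"
    and "r = n - part \<mu> 1"
    and "r' = n - part (conjugate \<mu>) 1"
  shows "(part (conjugate \<mu>) 1 > m \<longrightarrow> kostka \<mu> (replicate m l) = 0) \<and>
         kostka \<mu> (replicate m l) \<le> m ^ r \<and>
         kostka \<mu> (replicate m l) \<le> (n choose r) * kostka (delete_row \<mu>) (beta m r) \<and>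
         kostka \<mu> (replicate m l) \<le> (n choose r') * kostka (delete_column \<mu>) (beta m r')"
proof -
  let ?L = "length \<mu>" and ?f = "part \<mu>"
  have sorted: "sorted_wrt (\<ge>) \<mu>" and pos: "0 \<notin> set \<mu>" and sum: "sum_list \<mu> = n"
    using assms(4) by (simp_all add: is_partition_def)
  have f: "shape ?L ?f" using shape_part[OF sorted] by simp
  have size: "sum ?f {1..?L} = n" by (simp only: sum_part sum)
  \<comment> \<open>Partitions have no zero parts, so the first column meets every row of the
    list.\<close>
  have "filter (\<lambda>x. 1 \<le> x) \<mu> = \<mu>"
    using pos by (auto simp: filter_id_conv Suc_le_eq intro: gr0I)
  then have col: "part (conjugate \<mu>) 1 = ?L" using part_conjugate[OF sorted, of 1] by simp
  have part_pos: "1 \<le> ?f i" if "1 \<le> i" "i \<le> ?L" for i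
  proof -
    have "\<mu> ! (i - 1) \<in> set \<mu>" using that by simp
    then have "\<mu> ! (i - 1) \<noteq> 0" using pos by metis
    then show ?thesis using that by (simp add: Defs.part_def)
  qed
  have "kostka \<mu> (replicate m l) = 0" if "part (conjugate \<mu>) 1 > m"
    using tableaux_empty_if_long_column[OF f, of "replicate m l" ?L] that part_pos[of ?L] col
    by (simp add: kostka_def SSYT_eq_tableaux)
  moreover have "kostka \<mu> (replicate m l) \<le> m ^ r"
    using card_tableaux_le_power[OF f, of "replicate m l"] size assms(5)
    by (simp add: kostka_def SSYT_eq_tableaux)
  moreover have "kostka \<mu> (replicate m l) \<le> (n choose r) * kostka (delete_row \<mu>) (beta m r)"
    unfolding kostka_def SSYT_eq_tableaux assms(3) delete_row_def
  proof (rule card_tableaux_le_remove_line[OF f, where x = 1 and y = 0 and line = "\<lambda>j. (1, j)" and p = "?f 1"])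
    have "sorted_wrt (\<ge>) (tl \<mu>)" using sorted by (cases \<mu>) auto
    then show "shape ?L (part (tl \<mu>))" by (rule shape_part) simp
    show "diagram ?f = (\<lambda>(i, j). (i + 1, j + 0)) ` diagram (part (tl \<mu>)) \<union> (\<lambda>j. (1, j)) ` {1..?f 1}"
    proof (intro equalityI subsetI)
      fix c assume c: "c \<in> diagram ?f"
      \<comment> \<open>Row indices start at 1, so \<open>i = 0\<close> is the first row and the
        other cells are shifts of cells of \<open>tl \<mu>\<close>.\<close>
      then obtain i j where ij: "c = (Suc i, j)" by (cases c; cases "fst c") (auto simp: diagram_def)
      show "c \<in> (\<lambda>(i, j). (i + 1, j + 0)) ` diagram (part (tl \<mu>)) \<union> (\<lambda>j. (1, j)) ` {1..?f 1}"
        using c by (cases "i = 0") (auto simp: ij diagram_def part_tl image_iff)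
    qed (auto simp: diagram_def part_tl)
    show "(\<lambda>(i, j). (i + 1, j + 0)) ` diagram (part (tl \<mu>)) \<inter> (\<lambda>j. (1, j)) ` {1..?f 1} = {}"
      by (auto simp: diagram_def)
    fix U i j assume "tableau ?f U" "1 \<le> i" "i < j" "j \<le> ?f 1"
    then show "U (1, i) \<le> U (1, j)" by (auto simp: tableau_def diagram_def)
  qed (use assms(1,5) size in \<open>auto simp: inj_on_def\<close>)
  moreover have "kostka \<mu> (replicate m l) \<le> (n choose r') * kostka (delete_column \<mu>) (beta m r')"
    unfolding kostka_def SSYT_eq_tableaux assms(3)
  proof (rule card_tableaux_le_remove_line[OF f, where x = 0 and y = 1 and line = "\<lambda>i. (i, 1)" and p = ?L])
    note pc = part_delete_column[OF sorted]
    \<comment> \<open>Rows of length one disappear, but \<open>?L\<close> remains a valid bound, so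
      both shapes share it.\<close>
    show "shape ?L (part (delete_column \<mu>))"
      using f by (auto simp: shape_def pc)
    show "diagram ?f = (\<lambda>(i, j). (i + 0, j + 1)) ` diagram (part (delete_column \<mu>)) \<union> (\<lambda>i. (i, 1)) ` {1..?L}"
    proof (intro equalityI subsetI)
      fix c assume c: "c \<in> diagram ?f"
      then obtain i j where ij: "c = (i, Suc j)" by (cases c; cases "snd c") (auto simp: diagram_def)
      show "c \<in> (\<lambda>(i, j). (i + 0, j + 1)) ` diagram (part (delete_column \<mu>)) \<union> (\<lambda>i. (i, 1)) ` {1..?L}"
      proof (cases "j = 0")
        case True
        have "i \<le> ?L" using c f by (auto simp: ij diagram_def shape_def intro: leI)
        then show ?thesis using c True by (auto simp: ij diagram_def)
      next
        case False
        then show ?thesis using c by (auto simp: ij diagram_def pc image_iff)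
      qed
    qed (use part_pos in \<open>auto simp: diagram_def pc\<close>)
    show "(\<lambda>(i, j). (i + 0, j + 1)) ` diagram (part (delete_column \<mu>)) \<inter> (\<lambda>i. (i, 1)) ` {1..?L} = {}"
      by (auto simp: diagram_def)
    fix U i j assume *: "tableau ?f U" "1 \<le> i" "i < j" "j \<le> ?L"
    then have "(i, 1) \<in> diagram ?f" "(j, 1) \<in> diagram ?f"
      using part_pos[of i] part_pos[of j] by (auto simp: diagram_def)
    \<comment> \<open>Strict increase down the column is weakened to the monotonicity required of a
      line.\<close>
    then show "U (i, 1) \<le> U (j, 1)" using * by (auto simp: tableau_def intro: less_imp_le)
  qed (use assms(1,6) size col in \<open>auto simp: inj_on_def\<close>)
  ultimately show ?thesis by blast
qed

end
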